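(* For each prime power $q$ let $G_q$ be a bipartite graph without $4$-cycles whose two parts are two disjoint copies of $\mathbb{F}_q$ (so each part has $q$ vertices), and suppose $G_q$ has $(1+o(1))q^{3/2}$ edges as $q \to \infty$. Let \[ X'_q = \{ \langle (1, x, x^2, x^3, y, y^2, y^3)\rangle : x, y \in \mathbb{F}_q,\ \{x,y\} \text{ is an edge of } G_q \text{ (with } x \text{ in the first part and } y \text{ in the second)} \} \subseteq \mathrm{PG}(6,q). \] Then $|X'_q| = (1+o(1))q^{3/2}$ and $X'_q$ is a $(3,2)$-set, i.e. no plane of $\mathrm{PG}(6,q)$ contains more than $3$ points of $X'_q$.
   Context: $\mathrm{PG}(6,q)$ is the projective space whose points are the $1$-dimensional subspaces of $\mathbb{F}_q^{7}$; a plane is a $3$-dimensional vector subspace. A $(3,2)$-set is a set of points meeting every plane in at most $3$ points. *)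

theory Defs
  imports
    "Jordan_Normal_Form.Missing_VectorSpace"
    "HOL-Number_Theory.Prime_Powers"
    "HOL-Library.Landau_Symbols"
begin

text \<open>A simple graph is given by its set of edges, each edge being an unordered pair of vertices.\<close>

definition bipartite_graph :: "'v set \<Rightarrow> 'v set \<Rightarrow> 'v set set \<Rightarrow> bool" where
  "bipartite_graph A B E \<longleftrightarrow> A \<inter> B = {} \<and> (\<forall>e\<in>E. \<exists>a\<in>A. \<exists>b\<in>B. e = {a, b})"

definition has_4_cycle :: "'v set set \<Rightarrow> bool" where
  "has_4_cycle E \<longleftrightarrow> (\<exists>a b c d. distinct [a, b, c, d] \<and>
     {a, b} \<in> E \<and> {b, c} \<in> E \<and> {c, d} \<in> E \<and> {d, a} \<in> E)"

definition coord_space :: "'a ring \<Rightarrow> nat \<Rightarrow> ('a, nat \<Rightarrow> 'a) module" where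
  "coord_space K n = ring.func_space K {..<n}"

definition subspaces_of_dim :: "'a ring \<Rightarrow> nat \<Rightarrow> nat \<Rightarrow> (nat \<Rightarrow> 'a) set set" where
  "subspaces_of_dim K n d = {W. VectorSpace.subspace K W (coord_space K n) \<and>
     vectorspace.dim K ((coord_space K n)\<lparr>carrier := W\<rparr>) = d}"

text \<open>Points and planes of the projective space \<open>PG(n, K)\<close> are the vector subspaces of \<open>K\<^sup>n\<^sup>+\<^sup>1\<close> of
  dimension 1 and 3; incidence is inclusion.\<close>

definition pg_points :: "'a ring \<Rightarrow> nat \<Rightarrow> (nat \<Rightarrow> 'a) set set" where
  "pg_points K n = subspaces_of_dim K (Suc n) 1"

definition pg_planes :: "'a ring \<Rightarrow> nat \<Rightarrow> (nat \<Rightarrow> 'a) set set" where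
  "pg_planes K n = subspaces_of_dim K (Suc n) 3"

definition is_3_2_set :: "'a ring \<Rightarrow> nat \<Rightarrow> (nat \<Rightarrow> 'a) set set \<Rightarrow> bool" where
  "is_3_2_set K n X \<longleftrightarrow> X \<subseteq> pg_points K n \<and>
     (\<forall>\<pi>\<in>pg_planes K n. finite {P \<in> X. P \<subseteq> \<pi>} \<and> card {P \<in> X. P \<subseteq> \<pi>} \<le> 3)"

definition curve_vec :: "'a ring \<Rightarrow> 'a \<Rightarrow> 'a \<Rightarrow> nat \<Rightarrow> 'a" where
  "curve_vec K x y = (\<lambda>i\<in>{..<7}.
     [\<one>\<^bsub>K\<^esub>, x, x [^]\<^bsub>K\<^esub> (2::nat), x [^]\<^bsub>K\<^esub> (3::nat), y, y [^]\<^bsub>K\<^esub> (2::nat), y [^]\<^bsub>K\<^esub> (3::nat)] ! i)"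

text \<open>The two disjoint copies of \<open>K\<close> serving as vertex classes are \<open>Inl ` carrier K\<close> and
  \<open>Inr ` carrier K\<close>.\<close>

definition graph_point_set :: "'a ring \<Rightarrow> ('a + 'a) set set \<Rightarrow> (nat \<Rightarrow> 'a) set set" where
  "graph_point_set K E = {LinearCombinations.module.span K (coord_space K 7) {curve_vec K x y} | x y.
     x \<in> carrier K \<and> y \<in> carrier K \<and> {Inl x, Inr y} \<in> E}"

abbreviation primepow_at_top :: "nat filter" where
  "primepow_at_top \<equiv> inf at_top (principal {q. primepow q})"

end

theory Submission
  imports Defs "HOL-Algebra.Multiplicative_Group"
begin

text \<open>
  Suppose four points of the set lie in a plane; their vectors satisfy a nontrivial linear relation
  with coefficients \<open>c\<close>. The coordinates say that \<open>\<Sum> c p(x) = 0\<close> and \<open>\<Sum> c p(y) = 0\<close> for every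
  polynomial \<open>p\<close> of degree at most 3. Choosing \<open>p\<close> to vanish at all other \<open>x\<close>-values of the support
  shows that no \<open>x\<close>-value, and likewise no \<open>y\<close>-value, occurs exactly once in the support. So the at
  most four edges of the support form a nonempty bipartite graph of minimum degree 2, which must be
  a 4-cycle.
\<close>

section \<open>Vanishing power moments and repeated nodes\<close>

text \<open>Here \<open>k + card B\<close> is the degree of the polynomial X^k times the product of
  all X - b. Splitting off a factor X - r turns the sum into the one for exponent
  \<open>Suc k\<close> minus r times the one for \<open>k\<close>, so induction on \<open>B\<close>
  with \<open>k\<close> arbitrary works without expanding the product into coefficients.\<close>

lemma (in field) finsum_mult_prod_diff_eq_zero:
  assumes "finite T" "c \<in> T \<rightarrow> carrier R" "x \<in> T \<rightarrow> carrier R"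
    and mom: "\<And>k. k \<le> n \<Longrightarrow> (\<Oplus>t\<in>T. c t \<otimes> x t [^] k) = \<zero>"
    and "finite B" "B \<subseteq> carrier R" "k + card B \<le> n"
  shows "(\<Oplus>t\<in>T. c t \<otimes> x t [^] k \<otimes> (\<Otimes>b\<in>B. x t \<ominus> b)) = \<zero>"
  using assms(5-7)
proof (induction B arbitrary: k rule: finite_induct)
  case empty
  have "(\<Oplus>t\<in>T. c t \<otimes> x t [^] k \<otimes> \<one>) = (\<Oplus>t\<in>T. c t \<otimes> x t [^] k)"
    using assms(2,3) by (intro add.finprod_cong') (auto simp: Pi_iff)
  then show ?case using mom[of k] empty by simp
next
  case (insert r B)
  define P where "P t = (\<Otimes>b\<in>B. x t \<ominus> b)" for t
  have c: "c t \<in> carrier R" and x: "x t \<in> carrier R" and P: "P t \<in> carrier R" if "t \<in> T" for t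
    using assms(2,3) insert.prems that unfolding P_def by (auto intro!: finprod_closed)
  have r: "r \<in> carrier R" using insert.prems by auto
  have "(\<Oplus>t\<in>T. c t \<otimes> x t [^] k \<otimes> (\<Otimes>b\<in>insert r B. x t \<ominus> b))
      = (\<Oplus>t\<in>T. c t \<otimes> x t [^] Suc k \<otimes> P t \<oplus> (\<ominus> r) \<otimes> (c t \<otimes> x t [^] k \<otimes> P t))"
  proof (intro add.finprod_cong')
    fix t assume t: "t \<in> T"
    have "(\<Otimes>b\<in>insert r B. x t \<ominus> b) = (x t \<ominus> r) \<otimes> P t"
      using insert.hyps insert.prems x[OF t] unfolding P_def by (subst finprod_insert) auto
    moreover have "c t \<otimes> x t [^] k \<otimes> ((x t \<ominus> r) \<otimes> P t)
        = c t \<otimes> (x t [^] k \<otimes> x t) \<otimes> P t \<oplus> (\<ominus> r) \<otimes> (c t \<otimes> x t [^] k \<otimes> P t)"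
      using c[OF t] x[OF t] P[OF t] r nat_pow_closed[OF x[OF t], of k] by algebra
    ultimately show "c t \<otimes> x t [^] k \<otimes> (\<Otimes>b\<in>insert r B. x t \<ominus> b)
        = c t \<otimes> x t [^] Suc k \<otimes> P t \<oplus> (\<ominus> r) \<otimes> (c t \<otimes> x t [^] k \<otimes> P t)" by simp
  qed (use c x P r in \<open>auto simp: Pi_iff\<close>)
  also have "\<dots> = (\<Oplus>t\<in>T. c t \<otimes> x t [^] Suc k \<otimes> P t) \<oplus>
      (\<ominus> r) \<otimes> (\<Oplus>t\<in>T. c t \<otimes> x t [^] k \<otimes> P t)"
    using c x P r \<open>finite T\<close> by (subst finsum_addf) (auto simp: Pi_iff finsum_rdistr)
  also have "\<dots> = \<zero>"
    using insert.IH[of k] insert.IH[of "Suc k"] insert.hyps insert.prems r by (simp add: P_def)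
  finally show ?case .
qed

lemma (in domain) finprod_nonzero:
  assumes "finite A" "f \<in> A \<rightarrow> carrier R" "\<And>a. a \<in> A \<Longrightarrow> f a \<noteq> \<zero>"
  shows "finprod R f A \<noteq> \<zero>"
  using assms
proof (induction A rule: finite_induct)
  case (insert a A)
  then show ?case
    using integral[of "f a" "finprod R f A"] by (auto simp: Pi_iff)
qed simp

text \<open>A form of Vandermonde independence that allows repeated nodes. If the node of
  \<open>s\<close> occurred only once in the support of \<open>c\<close>, the polynomial vanishing
  at all other nodes of the support would have degree at most \<open>n\<close>, and it would reduce
  the vanishing sum to the single nonzero term at \<open>s\<close>.\<close>

lemma (in field) no_isolated_node_if_moments_vanish:
  assumes "finite T" "c \<in> T \<rightarrow> carrier R" "x \<in> T \<rightarrow> carrier R" "card T \<le> Suc n"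
    and mom: "\<And>k. k \<le> n \<Longrightarrow> (\<Oplus>t\<in>T. c t \<otimes> x t [^] k) = \<zero>"
    and s: "s \<in> T" "c s \<noteq> \<zero>"
  shows "\<exists>t\<in>T. t \<noteq> s \<and> c t \<noteq> \<zero> \<and> x t = x s"
proof (rule ccontr)
  assume isolated: "\<not> ?thesis"
  \<comment> \<open>Indices with zero coefficient are left out: they may share the node of
    \<open>s\<close>, and a factor for them would make \<open>P s\<close> vanish.\<close>
  define B where "B = x ` {t \<in> T. t \<noteq> s \<and> c t \<noteq> \<zero>}"
  define P where "P t = (\<Otimes>b\<in>B. x t \<ominus> b)" for t
  have B: "finite B" "B \<subseteq> carrier R" using assms(1,3) unfolding B_def by auto
  \<comment> \<open>Removing \<open>s\<close> from at most \<open>Suc n\<close> indices leaves at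
    most \<open>n\<close> roots, which is the highest degree the moments control.\<close>
  have "card B \<le> card (T - {s})"
    unfolding B_def using \<open>finite T\<close> by (intro order.trans[OF card_image_le] card_mono) auto
  then have "card B \<le> n" using assms(4) s \<open>finite T\<close> by simp
  then have "(\<Oplus>t\<in>T. c t \<otimes> x t [^] (0::nat) \<otimes> P t) = \<zero>"
    unfolding P_def by (intro finsum_mult_prod_diff_eq_zero[OF assms(1-3) mom B]) auto
  moreover have P: "P t \<in> carrier R" if "t \<in> T" for t
    using assms(3) B that unfolding P_def by (auto intro!: finprod_closed)
  moreover have "(\<Oplus>t\<in>T. c t \<otimes> x t [^] (0::nat) \<otimes> P t) = (\<Oplus>t\<in>T. c t \<otimes> P t)"
    using assms(2) P by (intro add.finprod_cong') (auto simp: Pi_iff)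
  ultimately have sum0: "(\<Oplus>t\<in>T. c t \<otimes> P t) = \<zero>" by simp
  have "c t \<otimes> P t = \<zero>" if t: "t \<in> T" "t \<noteq> s" for t
  proof (cases "c t = \<zero>")
    case False
    then have "x t \<in> B" using t unfolding B_def by auto
    moreover have "x t \<in> carrier R" using t assms(3) by auto
    ultimately have "P t = \<zero>"
      unfolding P_def using B by (intro finprod_zero) (auto intro!: bexI[of _ "x t"])
    then show ?thesis using assms(2) t by (simp add: Pi_iff)
  qed (use P t in auto)
  then have "(\<Oplus>t\<in>T. c t \<otimes> P t) = (\<Oplus>t\<in>T. if s = t then c t \<otimes> P t else \<zero>)"
    using assms(2) P by (intro add.finprod_cong') (auto simp: Pi_iff)
  also have "\<dots> = c s \<otimes> P s"
    using assms(1,2) P s by (intro add.finprod_singleton) (auto simp: Pi_iff)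
  finally have "P s = \<zero>" using sum0 s assms(2) P integral[of "c s" "P s"] by auto
  moreover have "P s \<noteq> \<zero>"
    unfolding P_def using B isolated s assms(3)
    by (intro finprod_nonzero) (auto simp: B_def Pi_iff)
  ultimately show False by simp
qed

section \<open>Linear algebra in coordinate spaces\<close>

text \<open>The coordinate spaces are only defined over rings without extra record fields.\<close>

locale coordinate_field = field R for R :: "'a ring" (structure)

lemma (in coordinate_field) coord_space_vectorspace: "vectorspace R (coord_space R n)"
proof -
  have "Module.module R (coord_space R n)"
    unfolding coord_space_def by (rule func_space_is_module)
  then show ?thesis by (simp add: vectorspace_def field_axioms)
qed

lemma (in coordinate_field) coord_space_simps:
  "carrier (coord_space R n) = ({..<n} \<rightarrow>\<^sub>E carrier R)"
  "\<zero>\<^bsub>coord_space R n\<^esub> = (\<lambda>i\<in>{..<n}. \<zero>)"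
  "v \<oplus>\<^bsub>coord_space R n\<^esub> w = (\<lambda>i\<in>{..<n}. v i \<oplus> w i)"
  "c \<odot>\<^bsub>coord_space R n\<^esub> v = (\<lambda>i\<in>{..<n}. c \<otimes> v i)"
  by (simp_all add: coord_space_def func_space_def)

text \<open>Taking a coordinate is linear. This turns one vector relation into the scalar equations
  that express the moments.\<close>

lemma (in coordinate_field) coord_space_lincomb_nth:
  assumes "finite A" "A \<subseteq> carrier (coord_space R n)" "a \<in> A \<rightarrow> carrier R" "i < n"
  shows "LinearCombinations.module.lincomb (coord_space R n) a A i = (\<Oplus>v\<in>A. a v \<otimes> v i)"
proof -
  interpret V: vectorspace R "coord_space R n" by (rule coord_space_vectorspace)
  show ?thesis
    using assms(1-3)
  proof (induction A rule: finite_induct)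
    case empty
    then show ?case using \<open>i < n\<close> by (simp add: V.lincomb_def coord_space_simps)
  next
    case (insert v A)
    have vi: "w i \<in> carrier R" if "w \<in> insert v A" for w
      using insert.prems(1) that \<open>i < n\<close> by (auto simp: coord_space_simps)
    have "V.lincomb a (A \<union> {v}) = a v \<odot>\<^bsub>coord_space R n\<^esub> v \<oplus>\<^bsub>coord_space R n\<^esub> V.lincomb a A"
      using insert by (intro V.lincomb_insert) auto
    then show ?case
      using insert vi \<open>i < n\<close> by (simp add: coord_space_simps Pi_iff)
  qed
qed

lemma (in vectorspace) span_singleton:
  assumes "v \<in> carrier V"
  shows "span {v} = (\<lambda>c. c \<odot>\<^bsub>V\<^esub> v) ` carrier K"
proof (intro equalityI subsetI)
  fix w assume "w \<in> span {v}"
  then obtain a A where A: "w = lincomb a A" "A \<subseteq> {v}" "a \<in> A \<rightarrow> carrier K"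
    unfolding span_def by auto
  show "w \<in> (\<lambda>c. c \<odot>\<^bsub>V\<^esub> v) ` carrier K"
  proof (cases "A = {}")
    case True
    \<comment> \<open>A span includes the empty combination, which is the multiple of
      \<open>v\<close> by zero.\<close>
    then have "w = \<zero>\<^bsub>K\<^esub> \<odot>\<^bsub>V\<^esub> v" using A assms by (simp add: lincomb_def)
    then show ?thesis by blast
  next
    case False
    then have "A = {v}" using A by auto
    then show ?thesis using A assms by (auto simp: lincomb_def)
  qed
next
  fix w assume "w \<in> (\<lambda>c. c \<odot>\<^bsub>V\<^esub> v) ` carrier K"
  then obtain c where c: "c \<in> carrier K" "w = c \<odot>\<^bsub>V\<^esub> v" by auto
  then have "w = lincomb (\<lambda>_. c) {v}" using assms by (simp add: lincomb_def)
  then show "w \<in> span {v}" unfolding span_def using c by blast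
qed

text \<open>The set \<open>{v}\<close> is a basis of its span: it is independent because the span of
  the empty set contains only the zero vector.\<close>

lemma (in vectorspace) dim_span_singleton:
  assumes "v \<in> carrier V" "v \<noteq> \<zero>\<^bsub>V\<^esub>"
  shows "vectorspace.dim K (vs (span {v})) = 1"
proof -
  have sub: "VectorSpace.subspace K (span {v}) V" using assms by (intro span_is_subspace) auto
  then interpret S: vectorspace K "vs (span {v})" by (rule subspace_is_vs)
  have v: "{v} \<subseteq> span {v}" using assms by (intro in_own_span) auto
  have "lin_indpt ({} \<union> {v})"
    using assms lin_dep_iff_in_span[of "{}" v]
    by (auto simp: lin_dep_def span_def lincomb_def)
  then have "S.basis {v}"
    using span_li_not_depend[OF v is_module[OF sub]] v by (simp add: S.basis_def)
  then show ?thesis using S.dim_basis[of "{v}"] by simp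
qed

section \<open>Independence of the curve vectors\<close>

lemma (in coordinate_field) curve_vec_carrier:
  assumes "x \<in> carrier R" "y \<in> carrier R"
  shows "curve_vec R x y \<in> carrier (coord_space R 7)"
proof -
  have "curve_vec R x y i \<in> carrier R" if "i < 7" for i
  proof -
    have "i \<in> {0, 1, 2, 3, 4, 5, 6}" using that by auto
    then show ?thesis using assms by (auto simp: curve_vec_def)
  qed
  then show ?thesis by (auto simp: coord_space_simps curve_vec_def)
qed

text \<open>Coordinate 0 fixes the scale of the vector, and coordinates 1 and 4 recover its two
  parameters.\<close>

lemma curve_vec_nth:
  "curve_vec K x y 0 = \<one>\<^bsub>K\<^esub>"
  "curve_vec K x y 1 = x"
  "curve_vec K x y 4 = y"
  by (simp_all add: curve_vec_def)

text \<open>Coordinate 0 serves as the zeroth power of both parameters. The positive powers of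
  \<open>y\<close> are shifted by 3, hence the case distinction in the index.\<close>

lemma (in coordinate_field) curve_vec_nth_powers:
  assumes "x \<in> carrier R" "y \<in> carrier R" "k \<le> 3"
  shows "curve_vec R x y k = x [^] k"
    and "curve_vec R x y (if k = 0 then 0 else k + 3) = y [^] k"
proof -
  have "k = 0 \<or> k = 1 \<or> k = 2 \<or> k = 3" using assms by auto
  then show "curve_vec R x y k = x [^] k"
    and "curve_vec R x y (if k = 0 then 0 else k + 3) = y [^] k"
    using assms by (auto simp: curve_vec_def nat_pow_0)
qed

text \<open>The bound 4 enters twice: moments of order 0 to 3 rule out isolated nodes among at most
  four vectors, and four distinct edges found in the support must already be all of
  \<open>A\<close>, which closes the cycle.\<close>

lemma (in coordinate_field) curve_vecs_lin_indpt:
  assumes "finite A" "card A \<le> 4"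
    and A: "\<And>v. v \<in> A \<Longrightarrow> \<exists>x\<in>carrier R. \<exists>y\<in>carrier R. {Inl x, Inr y} \<in> E \<and> v = curve_vec R x y"
    and C4_free: "\<not> has_4_cycle E"
  shows "\<not> LinearCombinations.module.lin_dep R (coord_space R 7) A"
proof
  interpret V: vectorspace R "coord_space R 7" by (rule coord_space_vectorspace)
  assume dep: "V.lin_dep A"
  \<comment> \<open>Each vector is identified with its edge, whose endpoints are read off from
    coordinates 1 and 4.\<close>
  have v: "v 1 \<in> carrier R" "v 4 \<in> carrier R" "{Inl (v 1), Inr (v 4)} \<in> E"
      "v = curve_vec R (v 1) (v 4)" if "v \<in> A" for v
    using A[OF that] by (auto simp: curve_vec_nth simp del: One_nat_def)
  have eqI: "v = w" if "v \<in> A" "w \<in> A" "v 1 = w 1" "v 4 = w 4" for v w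
    using v(4)[OF that(1)] v(4)[OF that(2)] that(3,4) by simp
  have AV: "A \<subseteq> carrier (coord_space R 7)"
    using v curve_vec_carrier by (metis subsetI)
  obtain a e1 where a: "a \<in> A \<rightarrow> carrier R" "V.lincomb a A = \<zero>\<^bsub>coord_space R 7\<^esub>"
    and e1: "e1 \<in> A" "a e1 \<noteq> \<zero>"
    using V.finite_lin_dep[OF \<open>finite A\<close> dep AV] by auto
  have sum0: "(\<Oplus>v\<in>A. a v \<otimes> v i) = \<zero>" if "i < 7" for i
    using coord_space_lincomb_nth[OF \<open>finite A\<close> AV a(1) that] a(2) that
    by (simp add: coord_space_simps)
  have nth: "v k = v 1 [^] k" "v (if k = 0 then 0 else k + 3) = v 4 [^] k"
    if "v \<in> A" "k \<le> 3" for v and k :: nat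
    using curve_vec_nth_powers[OF v(1,2)[OF that(1)] that(2)] v(4)[OF that(1)] by simp_all
  have "(\<Oplus>v\<in>A. a v \<otimes> v 1 [^] k) = \<zero>" if "k \<le> 3" for k :: nat
  proof -
    have "(\<Oplus>v\<in>A. a v \<otimes> v 1 [^] k) = (\<Oplus>v\<in>A. a v \<otimes> v k)"
      using a(1) v(1) by (intro add.finprod_cong') (auto simp: Pi_iff nth(1)[OF _ that])
    then show ?thesis using sum0[of k] that by simp
  qed
  then have x_twin: "\<exists>t\<in>A. t \<noteq> s \<and> a t \<noteq> \<zero> \<and> t 1 = s 1" if "s \<in> A" "a s \<noteq> \<zero>" for s
    using no_isolated_node_if_moments_vanish[of A a "\<lambda>v. v 1" 3 s] \<open>finite A\<close> a(1) v(1,2)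
      \<open>card A \<le> 4\<close> that by auto
  have "(\<Oplus>v\<in>A. a v \<otimes> v 4 [^] k) = \<zero>" if "k \<le> 3" for k :: nat
  proof -
    have "(\<Oplus>v\<in>A. a v \<otimes> v 4 [^] k) = (\<Oplus>v\<in>A. a v \<otimes> v (if k = 0 then 0 else k + 3))"
      using a(1) v(2) by (intro add.finprod_cong') (auto simp: Pi_iff nth(2)[OF _ that] simp del: if_split)
    then show ?thesis using sum0[of "if k = 0 then 0 else k + 3"] that by simp
  qed
  then have y_twin: "\<exists>t\<in>A. t \<noteq> s \<and> a t \<noteq> \<zero> \<and> t 4 = s 4" if "s \<in> A" "a s \<noteq> \<zero>" for s
    using no_isolated_node_if_moments_vanish[of A a "\<lambda>v. v 4" 3 s] \<open>finite A\<close> a(1) v(1,2)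
      \<open>card A \<le> 4\<close> that by auto
  \<comment> \<open>Edges \<open>e2\<close> and \<open>e3\<close> extend \<open>e1\<close> at its
    left and right endpoint. Then \<open>e4\<close> continues the path from \<open>e3\<close> on the
    left, and \<open>e5\<close> continues it from \<open>e2\<close> on the right.\<close>
  obtain e2 where e2: "e2 \<in> A" "a e2 \<noteq> \<zero>" "e2 \<noteq> e1" "e2 1 = e1 1"
    using x_twin[OF e1] by auto
  obtain e3 where e3: "e3 \<in> A" "a e3 \<noteq> \<zero>" "e3 \<noteq> e1" "e3 4 = e1 4"
    using y_twin[OF e1] by auto
  obtain e4 where e4: "e4 \<in> A" "e4 \<noteq> e3" "e4 1 = e3 1"
    using x_twin[OF e3(1,2)] by auto
  obtain e5 where e5: "e5 \<in> A" "e5 \<noteq> e2" "e5 4 = e2 4"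
    using y_twin[OF e2(1,2)] by auto
  have x13: "e1 1 \<noteq> e3 1" and y12: "e1 4 \<noteq> e2 4"
    using eqI[OF e1(1) e3(1)] eqI[OF e1(1) e2(1)] e2 e3 by auto
  then have "e1 \<noteq> e2" "e1 \<noteq> e3" "e1 \<noteq> e4" "e2 \<noteq> e3" "e2 \<noteq> e4" "e3 \<noteq> e4"
    using e2 e3 e4 by auto
  then have "card {e1, e2, e3, e4} = 4" by simp
  then have "{e1, e2, e3, e4} = A"
    using e1 e2 e3 e4 \<open>card A \<le> 4\<close> \<open>finite A\<close> by (intro card_seteq) auto
  \<comment> \<open>Both \<open>e1\<close> and \<open>e3\<close> have right endpoint
    \<open>e1 4\<close>, which differs from \<open>e2 4\<close>, so only \<open>e4\<close> is left.
    Hence \<open>e4\<close> joins \<open>e3 1\<close> to \<open>e2 4\<close>.\<close>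
  then have "e5 = e4"
    using e5 y12 e3 by auto
  then have "{Inl (e3 1), Inr (e2 4)} \<in> E" "{Inl (e3 1), Inr (e1 4)} \<in> E" "{Inl (e1 1), Inr (e2 4)} \<in> E"
    using v(3)[OF e4(1)] v(3)[OF e3(1)] v(3)[OF e2(1)] e2 e3 e4 e5 by auto
  then have "has_4_cycle E"
    unfolding has_4_cycle_def using v(3)[OF e1(1)] x13 y12
    \<comment> \<open>In this cyclic order the edges are \<open>e1\<close>, \<open>e3\<close>,
      \<open>e4\<close>, \<open>e2\<close>.\<close>
    by (intro exI[of _ "Inl (e1 1)"] exI[of _ "Inr (e1 4)"] exI[of _ "Inl (e3 1)"] exI[of _ "Inr (e2 4)"])
      (auto simp: insert_commute)
  then show False using C4_free by simp
qed

section \<open>From independence to points in a plane\<close>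

text \<open>A finite subspace is spanned by itself, hence finite-dimensional, and independence in
  the whole space carries over to it.\<close>

lemma (in vectorspace) card_lin_indpt_le_dim_finite_subspace:
  assumes W: "VectorSpace.subspace K W V" "finite W" and A: "A \<subseteq> W" "lin_indpt A"
  shows "card A \<le> vectorspace.dim K (vs W)"
proof -
  interpret W: vectorspace K "vs W" using W(1) by (rule subspace_is_vs)
  have "W.fin_dim"
    unfolding W.fin_dim_def
    using W(2) W.in_own_span[of W] W.span_is_subset2[of W] by (intro exI[of _ W]) auto
  then show ?thesis
    using A span_li_not_depend[OF A(1) is_module[OF W(1)]] by (intro W.li_le_dim) auto
qed

text \<open>Equal spans make the vectors proportional, and coordinate 0, which is one in both,
  forces the factor to be one.\<close>

lemma (in coordinate_field) curve_point_eqD: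
  assumes "x \<in> carrier R" "y \<in> carrier R" "x' \<in> carrier R" "y' \<in> carrier R"
    and eq: "LinearCombinations.module.span R (coord_space R 7) {curve_vec R x y}
      = LinearCombinations.module.span R (coord_space R 7) {curve_vec R x' y'}"
  shows "x = x' \<and> y = y'"
proof -
  interpret V: vectorspace R "coord_space R 7" by (rule coord_space_vectorspace)
  have v: "curve_vec R x y \<in> carrier (coord_space R 7)" "curve_vec R x' y' \<in> carrier (coord_space R 7)"
    using assms by (auto intro: curve_vec_carrier)
  then have "curve_vec R x y \<in> V.span {curve_vec R x' y'}"
    using V.in_own_span[of "{curve_vec R x y}"] eq by auto
  then obtain c where c: "c \<in> carrier R"
      "curve_vec R x y = c \<odot>\<^bsub>coord_space R 7\<^esub> curve_vec R x' y'"
    using V.span_singleton[OF v(2)] by auto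
  have nth: "curve_vec R x y i = c \<otimes> curve_vec R x' y' i" if "i < 7" for i
    unfolding c(2) using that by (simp add: coord_space_simps)
  have "c = \<one>" using nth[of 0] c(1) by (simp add: curve_vec_nth)
  then show ?thesis
    using nth[of 1] nth[of 4] assms by (simp add: curve_vec_nth del: One_nat_def)
qed

text \<open>Points and edges are both injective images of the set \<open>D\<close> of parameter
  pairs. Bipartiteness ensures that every edge arises from such a pair.\<close>

lemma (in coordinate_field) card_graph_point_set:
  assumes "bipartite_graph (Inl ` carrier R) (Inr ` carrier R) E"
  shows "card (graph_point_set R E) = card E"
proof -
  define D where "D = {(x, y). x \<in> carrier R \<and> y \<in> carrier R \<and> {Inl x, Inr y} \<in> E}"
  have "graph_point_set R E = (\<lambda>(x, y). LinearCombinations.module.span R (coord_space R 7) {curve_vec R x y}) ` D"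
    unfolding graph_point_set_def D_def by auto
  moreover have "inj_on (\<lambda>(x, y). LinearCombinations.module.span R (coord_space R 7) {curve_vec R x y}) D"
    unfolding D_def by (intro inj_onI, clarsimp) (rule curve_point_eqD)
  moreover have "E = (\<lambda>(x, y). {Inl x, Inr y}) ` D"
  proof (intro equalityI subsetI)
    fix e assume "e \<in> E"
    then obtain x y where "x \<in> carrier R" "y \<in> carrier R" "e = {Inl x, Inr y}"
      using assms unfolding bipartite_graph_def by blast
    then show "e \<in> (\<lambda>(x, y). {Inl x, Inr y}) ` D"
      using \<open>e \<in> E\<close> unfolding D_def by auto
  qed (auto simp: D_def)
  \<comment> \<open>The tags \<open>Inl\<close> and \<open>Inr\<close> let an unordered edge
    determine the ordered pair.\<close>
  moreover have "inj_on (\<lambda>(x, y). {Inl x, Inr y}) D"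
    by (intro inj_onI) (auto simp: doubleton_eq_iff)
  ultimately show ?thesis by (metis card_image)
qed

text \<open>Four points in a plane would yield four independent curve vectors in a space of
  dimension 3.\<close>

lemma (in coordinate_field) graph_point_set_is_3_2_set:
  assumes fin: "finite (carrier R)" and C4_free: "\<not> has_4_cycle E"
  shows "is_3_2_set R 6 (graph_point_set R E)"
proof -
  interpret V: vectorspace R "coord_space R 7" by (rule coord_space_vectorspace)
  define X where "X = graph_point_set R E"
  have X: "\<exists>v. P = V.span {v} \<and>
      (\<exists>x\<in>carrier R. \<exists>y\<in>carrier R. {Inl x, Inr y} \<in> E \<and> v = curve_vec R x y)" if "P \<in> X" for P
    using that unfolding X_def graph_point_set_def by blast
  then obtain v where v: "\<And>P. P \<in> X \<Longrightarrow> P = V.span {v P}"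
      "\<And>P. P \<in> X \<Longrightarrow> \<exists>x\<in>carrier R. \<exists>y\<in>carrier R. {Inl x, Inr y} \<in> E \<and> v P = curve_vec R x y"
    by metis
  have vV: "v P \<in> carrier (coord_space R 7)" if "P \<in> X" for P
    using v(2)[OF that] curve_vec_carrier by auto
  have "P \<in> pg_points R 6" if P: "P \<in> X" for P
  proof -
    have "v P 0 = \<one>" using v(2)[OF P] by (auto simp: curve_vec_nth)
    then have "v P \<noteq> \<zero>\<^bsub>coord_space R 7\<^esub>"
      by (auto simp: coord_space_simps)
    then show ?thesis
      using V.dim_span_singleton[OF vV[OF P]] V.span_is_subspace[of "{v P}"] vV[OF P] v(1)[OF P]
      by (simp add: pg_points_def subspaces_of_dim_def)
  qed
  moreover have "finite {P \<in> X. P \<subseteq> \<pi>} \<and> card {P \<in> X. P \<subseteq> \<pi>} \<le> 3" if "\<pi> \<in> pg_planes R 6" for \<pi>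
  proof
    have "X \<subseteq> (\<lambda>(x, y). V.span {curve_vec R x y}) ` (carrier R \<times> carrier R)"
      unfolding X_def graph_point_set_def by auto
    then have "finite X" using fin by (auto intro: finite_subset)
    then show "finite {P \<in> X. P \<subseteq> \<pi>}" by simp
    have \<pi>: "VectorSpace.subspace R \<pi> (coord_space R 7)" "vectorspace.dim R (V.vs \<pi>) = 3"
      using that by (simp_all add: pg_planes_def subspaces_of_dim_def)
    have "\<pi> \<subseteq> carrier (coord_space R 7)"
      using V.is_module[OF \<pi>(1)] by (rule submodule.subset)
    moreover have "finite (carrier (coord_space R 7))"
      using fin by (auto simp: coord_space_simps intro: finite_PiE)
    ultimately have "finite \<pi>" by (rule finite_subset)
    show "card {P \<in> X. P \<subseteq> \<pi>} \<le> 3"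
    proof (rule ccontr)
      assume "\<not> ?thesis"
      then obtain T where T: "T \<subseteq> {P \<in> X. P \<subseteq> \<pi>}" "card T = 4" "finite T"
        using obtain_subset_with_card_n[of 4 "{P \<in> X. P \<subseteq> \<pi>}"] by auto
      \<comment> \<open>A point is the span of its chosen vector, so distinct points have distinct
        vectors.\<close>
      have "inj_on v T" using v(1) T(1) by (intro inj_onI) (metis (no_types, lifting) mem_Collect_eq subsetD)
      then have card: "card (v ` T) = 4" using T by (simp add: card_image)
      have "\<not> V.lin_dep (v ` T)"
        using T v(2) card by (intro curve_vecs_lin_indpt[OF _ _ _ C4_free]) auto
      moreover have "v ` T \<subseteq> \<pi>"
      proof
        fix w assume "w \<in> v ` T"
        then obtain P where "P \<in> X" "P \<subseteq> \<pi>" "w = v P" using T by auto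
        then show "w \<in> \<pi>" using v(1)[of P] vV[of P] V.in_own_span[of "{v P}"] by auto
      qed
      ultimately have "card (v ` T) \<le> vectorspace.dim R (V.vs \<pi>)"
        using V.card_lin_indpt_le_dim_finite_subspace[OF \<pi>(1) \<open>finite \<pi>\<close>] by blast
      then show False using \<pi>(2) card by simp
    qed
  qed
  ultimately show ?thesis
    unfolding is_3_2_set_def X_def by blast
qed

theorem theorem9:
  fixes F :: "nat \<Rightarrow> 'a ring" and E :: "nat \<Rightarrow> ('a + 'a) set set"
  assumes field: "\<And>q. primepow q \<Longrightarrow> field (F q) \<and> card (carrier (F q)) = q"
    and bipartite: "\<And>q. primepow q \<Longrightarrow>
          bipartite_graph (Inl ` carrier (F q)) (Inr ` carrier (F q)) (E q)"
    and C4_free: "\<And>q. primepow q \<Longrightarrow> \<not> has_4_cycle (E q)"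
    and edges: "(\<lambda>q. real (card (E q))) \<sim>[primepow_at_top] (\<lambda>q. real q powr (3/2))"
  shows "(\<lambda>q. real (card (graph_point_set (F q) (E q)))) \<sim>[primepow_at_top] (\<lambda>q. real q powr (3/2))
    \<and> (\<forall>q. primepow q \<longrightarrow> is_3_2_set (F q) 6 (graph_point_set (F q) (E q)))"
proof
  have coordinate: "coordinate_field (F q)" if "primepow q" for q
    using field[OF that] by (simp add: coordinate_field_def)
  \<comment> \<open>The two counts agree at every prime power, and the filter only looks at
    those.\<close>
  have "\<forall>\<^sub>F q in primepow_at_top. real (card (graph_point_set (F q) (E q))) = real (card (E q))"
    using coordinate_field.card_graph_point_set[OF coordinate bipartite]
    by (auto simp: eventually_inf_principal)
  then show "(\<lambda>q. real (card (graph_point_set (F q) (E q)))) \<sim>[primepow_at_top] (\<lambda>q. real q powr (3/2))"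
    using edges by (subst asymp_equiv_cong) auto
  \<comment> \<open>An infinite set has \<open>card\<close> zero, so the positive cardinality
    \<open>q\<close> gives finiteness.\<close>
  have "finite (carrier (F q))" if "primepow q" for q
    using field[OF that] primepow_gt_0_nat[OF that] by (metis card_gt_0_iff)
  then show "\<forall>q. primepow q \<longrightarrow> is_3_2_set (F q) 6 (graph_point_set (F q) (E q))"
    using coordinate_field.graph_point_set_is_3_2_set[OF coordinate _ C4_free] by blast
qed

end
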